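(* Let $G$ be a group, let $R$ be a $G$-graded commutative ring with nonzero unity, let $\phi: GI(R)\to GI(R)\cup\{\emptyset\}$ be a function, and let $P$ be a proper graded ideal of $R$ such that $\phi(P)$ is a graded $r$-ideal of $R$. Then $P$ is a graded $\phi$-$r$-ideal of $R$ if and only if $P$ is a graded $r$-ideal of $R$.
   Context: $R=\bigoplus_{g\in G}R_g$ with additive subgroups $R_g$ satisfying $R_gR_h\subseteq R_{gh}$; $h(R)=\bigcup_{g\in G}R_g$ is the set of homogeneous elements. An ideal $P$ is graded if $P=\bigoplus_{g\in G}(P\cap R_g)$, and $GI(R)$ is the set of all graded ideals of $R$. Standing convention: $\phi(P)\subseteq P$ for every graded ideal $P$. For $x\in R$, $Ann(x)=\{a\in R: ax=0\}$. A proper graded ideal $P$ of $R$ is a graded $\phi$-$r$-ideal if whenever $x,y\in h(R)$ satisfy $xy\in P-\phi(P)$ (set difference) and $Ann(x)=\{0\}$, then $y\in P$. A proper graded ideal $P$ of $R$ is a graded $r$-ideal if whenever $x,y\in h(R)$, $xy\in P$ and $Ann(x)=\{0\}$, then $y\in P$. *)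

theory Defs
  imports "HOL-Algebra.Algebra"
begin

text \<open>\<open>A\<close> is the internal direct sum of the additive subgroups \<open>M i\<close>: summing up gives a bijection from
  the finitely supported families with \<open>f i \<in> M i\<close> onto \<open>A\<close>. The sum runs over the support, because
  \<open>finsum\<close> over an infinite index set is not the sum of the nonzero terms.\<close>

definition internal_direct_sum ::
    "('a, 'b) ring_scheme \<Rightarrow> 'i set \<Rightarrow> ('i \<Rightarrow> 'a set) \<Rightarrow> 'a set \<Rightarrow> bool" where
  "internal_direct_sum R I M A \<longleftrightarrow>
     (\<forall>i\<in>I. additive_subgroup (M i) R) \<and>
     bij_betw (\<lambda>f. \<Oplus>\<^bsub>R\<^esub>i\<in>{i \<in> I. f i \<noteq> \<zero>\<^bsub>R\<^esub>}. f i)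
       {f \<in> \<Pi>\<^sub>E i\<in>I. M i. finite {i \<in> I. f i \<noteq> \<zero>\<^bsub>R\<^esub>}} A"

definition is_grading ::
    "('g, 'c) monoid_scheme \<Rightarrow> ('a, 'b) ring_scheme \<Rightarrow> ('g \<Rightarrow> 'a set) \<Rightarrow> bool" where
  "is_grading G R S \<longleftrightarrow>
     internal_direct_sum R (carrier G) S (carrier R) \<and>
     (\<forall>g\<in>carrier G. \<forall>h\<in>carrier G. \<forall>x\<in>S g. \<forall>y\<in>S h. x \<otimes>\<^bsub>R\<^esub> y \<in> S (g \<otimes>\<^bsub>G\<^esub> h))"

definition homogeneous_elements :: "('g, 'c) monoid_scheme \<Rightarrow> ('g \<Rightarrow> 'a set) \<Rightarrow> 'a set" where
  "homogeneous_elements G S = (\<Union>g\<in>carrier G. S g)"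

definition graded_ideal ::
    "('g, 'c) monoid_scheme \<Rightarrow> ('a, 'b) ring_scheme \<Rightarrow> ('g \<Rightarrow> 'a set) \<Rightarrow> 'a set \<Rightarrow> bool" where
  "graded_ideal G R S P \<longleftrightarrow>
     ideal P R \<and> internal_direct_sum R (carrier G) (\<lambda>g. P \<inter> S g) P"

definition graded_ideals ::
    "('g, 'c) monoid_scheme \<Rightarrow> ('a, 'b) ring_scheme \<Rightarrow> ('g \<Rightarrow> 'a set) \<Rightarrow> 'a set set" where
  "graded_ideals G R S = {P. graded_ideal G R S P}"

definition Ann :: "('a, 'b) ring_scheme \<Rightarrow> 'a \<Rightarrow> 'a set" where
  "Ann R x = {a \<in> carrier R. a \<otimes>\<^bsub>R\<^esub> x = \<zero>\<^bsub>R\<^esub>}"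

definition graded_phi_r_ideal ::
    "('g, 'c) monoid_scheme \<Rightarrow> ('a, 'b) ring_scheme \<Rightarrow> ('g \<Rightarrow> 'a set) \<Rightarrow>
     ('a set \<Rightarrow> 'a set) \<Rightarrow> 'a set \<Rightarrow> bool" where
  "graded_phi_r_ideal G R S \<phi> P \<longleftrightarrow>
     graded_ideal G R S P \<and> P \<noteq> carrier R \<and>
     (\<forall>x\<in>homogeneous_elements G S. \<forall>y\<in>homogeneous_elements G S.
        x \<otimes>\<^bsub>R\<^esub> y \<in> P - \<phi> P \<and> Ann R x = {\<zero>\<^bsub>R\<^esub>} \<longrightarrow> y \<in> P)"

definition graded_r_ideal ::
    "('g, 'c) monoid_scheme \<Rightarrow> ('a, 'b) ring_scheme \<Rightarrow> ('g \<Rightarrow> 'a set) \<Rightarrow> 'a set \<Rightarrow> bool" where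
  "graded_r_ideal G R S P \<longleftrightarrow>
     graded_ideal G R S P \<and> P \<noteq> carrier R \<and>
     (\<forall>x\<in>homogeneous_elements G S. \<forall>y\<in>homogeneous_elements G S.
        x \<otimes>\<^bsub>R\<^esub> y \<in> P \<and> Ann R x = {\<zero>\<^bsub>R\<^esub>} \<longrightarrow> y \<in> P)"

end

theory Submission
  imports Defs
begin

text \<open>The two notions differ only in the products \<open>x \<otimes> y\<close> that lie in
  \<open>\<phi> P\<close>: the \<open>\<phi>\<close>-condition says nothing about them. Since
  \<open>\<phi> P\<close> is itself a graded r-ideal, it can deal with exactly these products, and
  the factor \<open>y\<close> it captures lies in \<open>P\<close> because
  \<open>\<phi> P \<subseteq> P\<close>.\<close>

theorem theorem2p7:
  fixes G :: "('g, 'c) monoid_scheme"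
    and R :: "('a, 'b) ring_scheme"
    and S :: "'g \<Rightarrow> 'a set"
    and \<phi> :: "'a set \<Rightarrow> 'a set"
    and P :: "'a set"
  assumes "group G"
    and "cring R"
    and "\<one>\<^bsub>R\<^esub> \<noteq> \<zero>\<^bsub>R\<^esub>"
    and "is_grading G R S"
    and "\<phi> \<in> graded_ideals G R S \<rightarrow> graded_ideals G R S \<union> {{}}"
    and "\<forall>Q\<in>graded_ideals G R S. \<phi> Q \<subseteq> Q"
    and "P \<in> graded_ideals G R S"
    and "P \<noteq> carrier R"
    and "graded_r_ideal G R S (\<phi> P)"
  shows "graded_phi_r_ideal G R S \<phi> P \<longleftrightarrow> graded_r_ideal G R S P"
proof
  have sub: "\<phi> P \<subseteq> P"
    using assms(6,7) by blast
  assume P: "graded_phi_r_ideal G R S \<phi> P"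
  have "y \<in> P"
    if "x \<in> homogeneous_elements G S" "y \<in> homogeneous_elements G S"
      and "x \<otimes>\<^bsub>R\<^esub> y \<in> P" "Ann R x = {\<zero>\<^bsub>R\<^esub>}" for x y
  \<comment> \<open>The split decides which ideal is used to cancel the regular factor
    \<open>x\<close>: \<open>\<phi> P\<close> for a product inside it, and \<open>P\<close> itself
    for a product in \<open>P - \<phi> P\<close>.\<close>
  proof (cases "x \<otimes>\<^bsub>R\<^esub> y \<in> \<phi> P")
    case True
    then have "y \<in> \<phi> P"
      using assms(9) that unfolding graded_r_ideal_def by blast
    then show ?thesis
      using sub by blast
  next
    case False
    then show ?thesis
      using P that unfolding graded_phi_r_ideal_def by blast
  qed
  then show "graded_r_ideal G R S P"
    using P unfolding graded_phi_r_ideal_def graded_r_ideal_def by blast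
next
  assume "graded_r_ideal G R S P"
  \<comment> \<open>The \<open>\<phi>\<close>-condition tests fewer products, those in
    \<open>P - \<phi> P\<close> instead of all those in \<open>P\<close>.\<close>
  then show "graded_phi_r_ideal G R S \<phi> P"
    unfolding graded_phi_r_ideal_def graded_r_ideal_def by blast
qed

end
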